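(* Consider the algorithm ABrA-GD described in the context, in the stated setting, and assume that its inner loop exits at every iteration. Let $M_k>\mu$ be the accepted acceleration parameters and let the accepted $t_k\in(0,1]$ and $\eta_k$ satisfy $$\mu+\eta_{k+1}^{-1}=M_kt_k^2\ \ (k\ge0),\qquad \eta_{k+1}^{-1}=(1-t_k)\eta_k^{-1}\ \ (k\ge1),\qquad t_0=1,\quad \eta_1^{-1}=M_0-\mu .$$ Then, for any $x_\star\in\arg\min_x\phi(x)$ and every $k\ge0$, $$\phi_{k+1}^{\mathrm{best}}\le\phi_k^{\mathrm{best}},\qquad \phi_{k+1}^{\mathrm{best}}\le\phi_\star^{\eta_{k+1}},\qquad \phi_{k+1}^{\mathrm{best}}-\phi_\star\le\eta_{k+1}^{-1}D_d(x_\star,x_0).$$ Moreover: (i) If $\mu=0$, then for every $k\ge1$ $$\eta_k^{-1}\le\frac{4}{\left(\sum_{i=0}^{k-1}M_i^{-1/2}\right)^2},$$ and if $M_i\le M$ for all $i\ge K$ (for some $M>0$ and $K\ge1$), then for every $k\ge K$ $$\eta_k^{-1}\le\frac{\eta_K^{-1}}{\left(1+\frac{k-K}{2\sqrt{M\eta_K}}\right)^2}.$$ (ii) If $\mu>0$, then for every $k\ge1$ $$\eta_k^{-1}\le(M_0-\mu)\prod_{i=1}^{k-1}\left(1-\sqrt{\frac{\mu}{M_i}}\right),$$ and if $M_i\le M$ for all $i\ge K$ (for some $M>0$ and $K\ge1$), then for every $k\ge K$ $$\eta_k^{-1}\le\eta_K^{-1}\left(1-\sqrt{\frac{\mu}{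M}}\right)^{k-K}.$$
   Context: Setting. $d:\mathbb R^n\to\mathbb R\cup\{+\infty\}$ is a Legendre function: proper, closed, convex, differentiable on $\operatorname{int}(\operatorname{dom} d)$ with $\|\nabla d(u_j)\|\to\infty$ whenever $u_j$ tends to a boundary point of $\operatorname{dom} d$, and strictly convex on every convex subset of $\operatorname{dom}\partial d$. The Bregman divergence is $D_d(x,y)=d(x)-d(y)-\langle\nabla d(y),x-y\rangle$. $\mathcal X=\operatorname{cl}(\operatorname{dom} d)$, $x_0\in\operatorname{int}(\operatorname{dom} d)$. $f:\mathcal X\to\mathbb R$ is convex, differentiable, and relatively $(L-\mu)$-smooth with respect to $d$, i.e. $f(x)-f(y)-\langle\nabla f(y),x-y\rangle\le(L-\mu)D_d(x,y)$ for $x,y\in\operatorname{int}(\mathcal X)$, with $0\le\mu<L$. The objective is $\phi(x)=f(x)+\mu D_d(x,x_0)$, $\phi_\star=\min_{\mathcal X}\phi$; equivalently $\phi$ is $L$-smooth and $\mu$-strongly convex relative to $d$: $\mu D_d(x,y)\le\phi(x)-\phi(y)-\langle\nabla\phi(y),x-y\rangle\le LD_d(x,y)$. Standing convention: all minimizers appearing (of $\phi$ and of the subproblems) exist and lie in $\operatorname{int}(\operatorname{dom} d)$, so that they are characterized by stationarity. For $\eta>0$: $\phi^\eta(x)=\phi(x)+\frac1\eta D_d(x,x_0)$ and $\phi^\eta_\star=\min_x\phi^\eta(x)$. Algorithm ABrA-GD. Inputs: $x_0$, $\mu$, $\phi$, initial estimates $L_{\mathrm{cur}}=L_0>0$ and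 $M_{-1}>0$. Initialization: $x_0^{\mathrm{best}}=z_0=x_0$, $\lambda_0=0$, $\eta_0=0$ (with $\eta_0^{-1}=+\infty$), $\phi_0^{\mathrm{best}}=\phi(x_0)$, $t_0=1$. For $k=0,1,2,\dots$: set $M_k\leftarrow\max\{M_{k-1}/4,\mu\}$, $L_{\mathrm{cur}}\leftarrow\max\{L_{\mathrm{cur}}/2,\mu\}$, $\phi^{\mathrm{best}}_{k+1}\leftarrow\phi^{\mathrm{best}}_k$, $x^{\mathrm{best}}_{k+1}\leftarrow x^{\mathrm{best}}_k$; then run the inner loop, repeating the following trial until the exit condition holds: (1) $M_k\leftarrow2M_k$. For $k\ge1$, $t_k=\min\left\{1,\frac{2(\eta_k^{-1}+\mu)}{\eta_k^{-1}+\sqrt{\eta_k^{-2}+4M_k(\eta_k^{-1}+\mu)}}\right\}$ (and $t_0=1$); $\eta_{k+1}^{-1}=M_kt_k^2-\mu$; $\tau_k=\frac{t_k-\mu/\sqrt{M_kL_{\mathrm{cur}}}}{1-\mu/\sqrt{M_kL_{\mathrm{cur}}}}$. (2) $y_k=(1-\tau_k)x_k^{\mathrm{best}}+\tau_kz_k$ and $\phi_k^{\mathrm{low}}=\phi(y_k)+\langle\nabla\phi(y_k),z_k-y_k\rangle+\mu D_d(z_k,y_k)$. (3) Backtracking gradient step: starting from $L_{\mathrm{new}}=L_{\mathrm{cur}}/2$, repeat $L_{\mathrm{new}}\leftarrow2L_{\mathrm{new}}$, $x_{k+1}=\arg\min_x\{\langle\nabla\phi(y_k),x\rangle+L_{\mathrm{new}}D_d(x,y_k)\}$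 until $\phi(x_{k+1})\le\phi(y_k)+\langle\nabla\phi(y_k),x_{k+1}-y_k\rangle+L_{\mathrm{new}}D_d(x_{k+1},y_k)$; then $L_{\mathrm{cur}}\leftarrow L_{\mathrm{new}}$. (4) $\lambda_{k+1}=(1-t_k)\lambda_k+t_k\nabla f(y_k)$, where $\nabla f(y_k)=\nabla\phi(y_k)-\mu(\nabla d(y_k)-\nabla d(x_0))$, and $z_{k+1}=\arg\min_u\{\langle\lambda_{k+1},u\rangle+(\mu+\eta_{k+1}^{-1})D_d(u,x_0)\}$. (5) If $\phi^{\mathrm{best}}_{k+1}>\phi(x_{k+1})$, then $\phi^{\mathrm{best}}_{k+1}\leftarrow\phi(x_{k+1})$ and $x^{\mathrm{best}}_{k+1}\leftarrow x_{k+1}$. Exit condition: $\phi^{\mathrm{best}}_{k+1}\le(1-t_k)\phi_k^{\mathrm{best}}+t_k\phi_k^{\mathrm{low}}-(\mu+\eta_{k+1}^{-1})D_d(z_k,z_{k+1})$. The value of $M_k$ (and $t_k$, $\eta_{k+1}$, $x_{k+1}$, $z_{k+1}$, $\lambda_{k+1}$) at exit is called accepted. *)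

theory Defs
  imports "HOL-Analysis.Analysis"
begin

section \<open>Legendre functions and Bregman divergences\<close>

definition grad :: "('a::euclidean_space \<Rightarrow> real) \<Rightarrow> 'a \<Rightarrow> 'a"
  where "grad F x = (THE g. GDERIV F x :> g)"

definition edom :: "('a \<Rightarrow> ereal) \<Rightarrow> 'a set"
  where "edom d = {x. d x < \<infinity>}"

definition rval :: "('a \<Rightarrow> ereal) \<Rightarrow> 'a \<Rightarrow> real"
  where "rval d x = real_of_ereal (d x)"

definition subdifferential :: "('a::euclidean_space \<Rightarrow> ereal) \<Rightarrow> 'a \<Rightarrow> 'a set"
  where "subdifferential d x = {g. \<forall>u. d x + ereal (g \<bullet> (u - x)) \<le> d u}"

definition strictly_convex_on :: "'a::real_vector set \<Rightarrow> ('a \<Rightarrow> real) \<Rightarrow> bool"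
  where "strictly_convex_on S F \<longleftrightarrow>
    (\<forall>x\<in>S. \<forall>y\<in>S. \<forall>a. x \<noteq> y \<and> 0 < a \<and> a < 1 \<longrightarrow>
       F ((1 - a) *\<^sub>R x + a *\<^sub>R y) < (1 - a) * F x + a * F y)"

text \<open>
  For a proper \<open>d\<close>, the set \<open>epigraph (edom d) (rval d)\<close> is the usual epigraph of \<open>d\<close>,
  so its closedness says that \<open>d\<close> is closed (lower semicontinuous).
\<close>

definition legendre :: "('a::euclidean_space \<Rightarrow> ereal) \<Rightarrow> bool"
  where "legendre d \<longleftrightarrow>
    (\<forall>x. d x \<noteq> -\<infinity>) \<and> edom d \<noteq> {} \<and>
    closed (epigraph (edom d) (rval d)) \<and>
    convex_on (edom d) (rval d) \<and>
    rval d differentiable_on interior (edom d) \<and>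
    (\<forall>u x. (\<forall>j. u j \<in> interior (edom d)) \<and> x \<in> frontier (edom d) \<and> u \<longlonglongrightarrow> x \<longrightarrow>
       filterlim (\<lambda>j. norm (grad (rval d) (u j))) at_top sequentially) \<and>
    (\<forall>S. convex S \<and> S \<subseteq> {x. subdifferential d x \<noteq> {}} \<longrightarrow> strictly_convex_on S (rval d))"

text \<open>The second argument is meant to range over the interior of the domain.\<close>

definition bregman :: "('a::euclidean_space \<Rightarrow> ereal) \<Rightarrow> 'a \<Rightarrow> 'a \<Rightarrow> ereal"
  where "bregman d x y = d x - d y - ereal (grad (rval d) y \<bullet> (x - y))"

definition relatively_smooth ::
  "('a::euclidean_space \<Rightarrow> ereal) \<Rightarrow> ('a \<Rightarrow> real) \<Rightarrow> real \<Rightarrow> bool"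
  where "relatively_smooth d f c \<longleftrightarrow>
    (\<forall>x \<in> interior (closure (edom d)). \<forall>y \<in> interior (closure (edom d)).
       ereal (f x - f y - grad f y \<bullet> (x - y)) \<le> ereal c * bregman d x y)"

section \<open>Objective and regularized objective\<close>

text \<open>
  Objectives take values in the extended reals, since \<open>d\<close> may be infinite on part of the
  boundary of its domain. For \<open>\<mu> = 0\<close> the product \<open>0 * \<infinity> = 0\<close> makes the
  objective equal to \<open>f\<close> on the whole closure of the domain.
\<close>

definition phi ::
  "('a::euclidean_space \<Rightarrow> ereal) \<Rightarrow> ('a \<Rightarrow> real) \<Rightarrow> real \<Rightarrow> 'a \<Rightarrow> 'a \<Rightarrow> ereal"
  where "phi d f \<mu> x0 x = ereal (f x) + ereal \<mu> * bregman d x x0"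

definition phi_reg ::
  "('a::euclidean_space \<Rightarrow> ereal) \<Rightarrow> ('a \<Rightarrow> real) \<Rightarrow> real \<Rightarrow> 'a \<Rightarrow> real \<Rightarrow> 'a \<Rightarrow> ereal"
  where "phi_reg d f \<mu> x0 \<eta> x = phi d f \<mu> x0 x + ereal (1 / \<eta>) * bregman d x x0"

definition is_minimizer :: "('a::euclidean_space \<Rightarrow> ereal) \<Rightarrow> ('a \<Rightarrow> ereal) \<Rightarrow> 'a \<Rightarrow> bool"
  where "is_minimizer d F x \<longleftrightarrow> is_arg_min F (\<lambda>u. u \<in> closure (edom d)) x"

definition min_value :: "('a::euclidean_space \<Rightarrow> ereal) \<Rightarrow> ('a \<Rightarrow> ereal) \<Rightarrow> ereal"
  where "min_value d F = (INF x \<in> closure (edom d). F x)"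

text \<open>Minimizers exist and all lie in the interior of the domain; then \<open>min_value\<close> is attained.\<close>

definition has_interior_minimizer :: "('a::euclidean_space \<Rightarrow> ereal) \<Rightarrow> ('a \<Rightarrow> ereal) \<Rightarrow> bool"
  where "has_interior_minimizer d F \<longleftrightarrow>
    (\<exists>x. is_minimizer d F x) \<and> (\<forall>x. is_minimizer d F x \<longrightarrow> x \<in> interior (edom d))"

section \<open>The algorithm ABrA-GD\<close>

text \<open>
  \<open>bregman_prox d g c y x\<close>: the point \<open>x\<close> minimizes \<open>\<langle>g, u\<rangle> + c D(u, y)\<close> over \<open>u\<close> and lies
  in the interior of the domain.
\<close>

definition bregman_prox ::
  "('a::euclidean_space \<Rightarrow> ereal) \<Rightarrow> 'a \<Rightarrow> real \<Rightarrow> 'a \<Rightarrow> 'a \<Rightarrow> bool"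
  where "bregman_prox d g c y x \<longleftrightarrow>
    is_minimizer d (\<lambda>u. ereal (g \<bullet> u) + ereal c * bregman d u y) x \<and> x \<in> interior (edom d)"

definition sufficient_descent ::
  "('a::euclidean_space \<Rightarrow> ereal) \<Rightarrow> ('a \<Rightarrow> ereal) \<Rightarrow> 'a \<Rightarrow> real \<Rightarrow> 'a \<Rightarrow> bool"
  where "sufficient_descent d \<phi> y L x \<longleftrightarrow>
    \<phi> x \<le> \<phi> y + ereal (grad (rval \<phi>) y \<bullet> (x - y)) + ereal L * bregman d x y"

text \<open>
  \<open>backtrack d \<phi> y L L' x\<close>: backtracking at \<open>y\<close>, with \<open>L\<close> as the first value tried, stops with
  the value \<open>L'\<close> and the point \<open>x\<close>.
\<close>

inductive backtrack ::
  "('a::euclidean_space \<Rightarrow> ereal) \<Rightarrow> ('a \<Rightarrow> ereal) \<Rightarrow> 'a \<Rightarrow> real \<Rightarrow> real \<Rightarrow> 'a \<Rightarrow> bool"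
  for d \<phi> y where
  accept: "\<lbrakk>bregman_prox d (grad (rval \<phi>) y) L y x; sufficient_descent d \<phi> y L x\<rbrakk>
    \<Longrightarrow> backtrack d \<phi> y L L x"
| increase: "\<lbrakk>bregman_prox d (grad (rval \<phi>) y) L y x; \<not> sufficient_descent d \<phi> y L x;
      backtrack d \<phi> y (2 * L) L' x'\<rbrakk>
    \<Longrightarrow> backtrack d \<phi> y L L' x'"

text \<open>
  The state \<open>s k\<close> with which the outer iteration \<open>k\<close> starts holds \<open>\<eta>\<^sub>k\<close>, \<open>\<lambda>\<^sub>k\<close>, \<open>z\<^sub>k\<close> and the
  best point and value so far, but \<open>M\<close>, \<open>t\<close>, and \<open>\<phi>\<^sup>l\<^sup>o\<^sup>w\<close> with index \<open>k - 1\<close>, since these are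
  produced by the preceding iteration.
\<close>

record 'a abra_state =
  st_M :: real
  st_L :: real
  st_t :: real
  st_eta :: real
  st_lam :: 'a
  st_z :: 'a
  st_low :: ereal
  st_xbest :: 'a
  st_best :: ereal

text \<open>
  The values of \<open>st_t\<close> and \<open>st_low\<close> below are never read. Neither is \<open>1 / \<eta>\<^sub>0\<close>, which is \<open>0\<close> in
  HOL but stands for \<open>+\<infinity>\<close>: iteration \<open>0\<close> uses \<open>t\<^sub>0 = 1\<close>.
\<close>

definition abra_init ::
  "('a::euclidean_space \<Rightarrow> ereal) \<Rightarrow> ('a \<Rightarrow> real) \<Rightarrow> real \<Rightarrow> 'a \<Rightarrow> real \<Rightarrow> real \<Rightarrow> 'a abra_state"
  where "abra_init d f \<mu> x0 L0 Minit =
    \<lparr>st_M = Minit, st_L = L0, st_t = 1, st_eta = 0, st_lam = 0, st_z = x0,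
     st_low = 0, st_xbest = x0, st_best = phi d f \<mu> x0 x0\<rparr>"

definition abra_prepare :: "real \<Rightarrow> 'a abra_state \<Rightarrow> 'a abra_state"
  where "abra_prepare \<mu> s = s\<lparr>st_M := max (st_M s / 4) \<mu>, st_L := max (st_L s / 2) \<mu>\<rparr>"

definition abra_t :: "real \<Rightarrow> nat \<Rightarrow> real \<Rightarrow> real \<Rightarrow> real"
  where "abra_t \<mu> k \<eta> M =
    (if k = 0 then 1
     else min 1 (2 * (1/\<eta> + \<mu>) / (1/\<eta> + sqrt ((1/\<eta>)\<^sup>2 + 4 * M * (1/\<eta> + \<mu>)))))"

text \<open>
  \<open>abra_trial d f \<mu> x0 k s r r'\<close>: one trial of the inner loop of iteration \<open>k\<close>, where \<open>s\<close> is the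
  state at the start of the iteration and \<open>r\<close>, \<open>r'\<close> are the working states before and after the
  trial. The fields of \<open>r\<close> that are read are those that persist between trials: \<open>M\<^sub>k\<close>, the
  current smoothness estimate, and the best point and value of index \<open>k + 1\<close>.
\<close>

definition abra_trial ::
  "('a::euclidean_space \<Rightarrow> ereal) \<Rightarrow> ('a \<Rightarrow> real) \<Rightarrow> real \<Rightarrow> 'a \<Rightarrow> nat \<Rightarrow>
   'a abra_state \<Rightarrow> 'a abra_state \<Rightarrow> 'a abra_state \<Rightarrow> bool"
  where "abra_trial d f \<mu> x0 k s r r' \<longleftrightarrow>
    (let \<phi> = phi d f \<mu> x0;
         M = 2 * st_M r;
         t = abra_t \<mu> k (st_eta s) M;
         \<eta> = 1 / (M * t\<^sup>2 - \<mu>);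
         q = \<mu> / sqrt (M * st_L r);
         \<tau> = (t - q) / (1 - q);
         y = (1 - \<tau>) *\<^sub>R st_xbest s + \<tau> *\<^sub>R st_z s;
         low = \<phi> y + ereal (grad (rval \<phi>) y \<bullet> (st_z s - y)) + ereal \<mu> * bregman d (st_z s) y;
         \<nu> = (1 - t) *\<^sub>R st_lam s + t *\<^sub>R grad f y
     in \<exists>L x z. backtrack d \<phi> y (st_L r) L x \<and> bregman_prox d \<nu> (\<mu> + 1/\<eta>) x0 z \<and>
          r' = \<lparr>st_M = M, st_L = L, st_t = t, st_eta = \<eta>, st_lam = \<nu>, st_z = z, st_low = low,
                st_xbest = (if st_best r > \<phi> x then x else st_xbest r),
                st_best = (if st_best r > \<phi> x then \<phi> x else st_best r)\<rparr>)"

definition abra_exit ::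
  "('a::euclidean_space \<Rightarrow> ereal) \<Rightarrow> real \<Rightarrow> 'a abra_state \<Rightarrow> 'a abra_state \<Rightarrow> bool"
  where "abra_exit d \<mu> s r \<longleftrightarrow>
    st_best r \<le> ereal (1 - st_t r) * st_best s + ereal (st_t r) * st_low r
      - ereal (\<mu> + 1 / st_eta r) * bregman d (st_z s) (st_z r)"

inductive abra_inner ::
  "('a::euclidean_space \<Rightarrow> ereal) \<Rightarrow> ('a \<Rightarrow> real) \<Rightarrow> real \<Rightarrow> 'a \<Rightarrow> nat \<Rightarrow>
   'a abra_state \<Rightarrow> 'a abra_state \<Rightarrow> 'a abra_state \<Rightarrow> bool"
  for d f \<mu> x0 k s where
  stop: "\<lbrakk>abra_trial d f \<mu> x0 k s r r'; abra_exit d \<mu> s r'\<rbrakk> \<Longrightarrow> abra_inner d f \<mu> x0 k s r r'"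
| again: "\<lbrakk>abra_trial d f \<mu> x0 k s r r'; \<not> abra_exit d \<mu> s r'; abra_inner d f \<mu> x0 k s r' r''\<rbrakk>
    \<Longrightarrow> abra_inner d f \<mu> x0 k s r r''"

text \<open>An infinite run in which the inner loop exits after finitely many trials at every iteration.\<close>

definition abra_run ::
  "('a::euclidean_space \<Rightarrow> ereal) \<Rightarrow> ('a \<Rightarrow> real) \<Rightarrow> real \<Rightarrow> 'a \<Rightarrow> real \<Rightarrow> real \<Rightarrow>
   (nat \<Rightarrow> 'a abra_state) \<Rightarrow> bool"
  where "abra_run d f \<mu> x0 L0 Minit s \<longleftrightarrow>
    s 0 = abra_init d f \<mu> x0 L0 Minit \<and>
    (\<forall>k. abra_inner d f \<mu> x0 k (s k) (abra_prepare \<mu> (s k)) (s (Suc k)))"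

end

theory Submission
  imports Defs
begin

text \<open>
  The proof is an estimate-sequence argument. The affine functions
  \<open>l\<^sub>k(u) = f(y\<^sub>k) + \<langle>\<nabla>f(y\<^sub>k), u - y\<^sub>k\<rangle>\<close> minorize \<open>f\<close>, and so do their convex combinations
  \<open>A\<^sub>k\<^sub>+\<^sub>1 = (1 - t\<^sub>k) A\<^sub>k + t\<^sub>k l\<^sub>k\<close>, whose linear parts are \<open>\<lambda>\<^sub>k\<^sub>+\<^sub>1\<close>; hence \<open>z\<^sub>k\<close> minimizes
  \<open>A\<^sub>k + (\<mu> + 1/\<eta>\<^sub>k) D(\<cdot>, x\<^sub>0)\<close>. By the three-point identity the lower model at \<open>z\<^sub>k\<close> equals
  \<open>l\<^sub>k(z\<^sub>k) + \<mu> D(z\<^sub>k, x\<^sub>0)\<close>, and the optimality of \<open>z\<^sub>k\<^sub>+\<^sub>1\<close> absorbs the term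
  \<open>(\<mu> + 1/\<eta>\<^sub>k\<^sub>+\<^sub>1) D(z\<^sub>k, z\<^sub>k\<^sub>+\<^sub>1)\<close> of the exit test, so inductively the best value is at most this
  minimum, which is at most the minimum of the regularized objective.

  For the rates write \<open>a\<^sub>k = 1/\<eta>\<^sub>k\<close>. If \<open>\<mu> = 0\<close>, then \<open>sqrt (1 - t) \<le> 1 - t/2\<close> gives
  \<open>a\<^sub>k\<^sub>+\<^sub>1\<^bsup>-1/2\<^esup> \<ge> a\<^sub>k\<^bsup>-1/2\<^esup> + M\<^sub>k\<^bsup>-1/2\<^esup>/2\<close>. If \<open>\<mu> > 0\<close>, then \<open>M\<^sub>k t\<^sub>k\<^sup>2 \<ge> \<mu>\<close> gives
  \<open>a\<^sub>k\<^sub>+\<^sub>1 \<le> (1 - sqrt (\<mu>/M\<^sub>k)) a\<^sub>k\<close>.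
\<close>

section \<open>Gradients\<close>

lemma GDERIV_unique:
  fixes F :: "'a::real_inner \<Rightarrow> real"
  assumes "GDERIV F x :> g" "GDERIV F x :> h"
  shows "g = h"
proof -
  have "(\<lambda>v. v \<bullet> g) = (\<lambda>v. v \<bullet> h)"
    using assms unfolding gderiv_def by (rule has_derivative_unique)
  then have "(g - h) \<bullet> g = (g - h) \<bullet> h" by metis
  then have "(g - h) \<bullet> (g - h) = 0" by (simp add: inner_diff_right)
  then show ?thesis by simp
qed

lemma grad_eqI: "GDERIV F x :> g \<Longrightarrow> grad F x = g"
  unfolding grad_def using GDERIV_unique by blast

text \<open>The adjoint of the derivative, applied to \<open>1\<close>, represents the derivative as
  an inner product; uniqueness identifies it with the description in \<open>grad\<close>.\<close>

lemma GDERIV_grad: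
  assumes "F differentiable (at x)"
  shows "GDERIV F x :> grad F x"
proof -
  obtain F' where F': "(F has_derivative F') (at x)"
    using assms by (auto simp: differentiable_def)
  then have "linear F'" by (rule has_derivative_linear)
  then have "F' = (\<lambda>h. h \<bullet> adjoint F' 1)"
    by (simp add: adjoint_works)
  with F' have "GDERIV F x :> adjoint F' 1" by (simp add: gderiv_def)
  then show ?thesis using grad_eqI by metis
qed

lemma GDERIV_inner: "GDERIV (\<lambda>u. g \<bullet> u) x :> g"
  unfolding gderiv_def by (auto intro!: derivative_eq_intros simp: inner_commute)

lemma GDERIV_cmult: "GDERIV F x :> g \<Longrightarrow> GDERIV (\<lambda>u. c * F u) x :> c *\<^sub>R g"
  for F :: "'a::real_inner \<Rightarrow> real"
  unfolding gderiv_def by (auto intro!: derivative_eq_intros)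

lemma GDERIV_transform_open:
  assumes "GDERIV F x :> g" "open S" "x \<in> S" "\<And>u. u \<in> S \<Longrightarrow> F u = G u"
  shows "GDERIV G x :> g"
  using assms unfolding gderiv_def by (blast intro: has_derivative_transform_within_open)

lemma GDERIV_min_zero:
  assumes "GDERIV F x :> g" "open S" "x \<in> S" "\<And>u. u \<in> S \<Longrightarrow> F x \<le> F u"
  shows "g = 0"
proof -
  have "(\<lambda>h. h \<bullet> g) = (\<lambda>h. 0)"
    using assms unfolding gderiv_def
    by (intro differential_zero_maxmin[of x S F]) auto
  then have "g \<bullet> g = 0" by metis
  then show ?thesis by simp
qed

text \<open>Restricting \<open>F\<close> to the line through \<open>y\<close> and \<open>u\<close>
  reduces this to the one-dimensional tangent inequality. Only \<open>y\<close> has to be interior,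
  so \<open>u\<close> may be a boundary point.\<close>

lemma convex_on_gradient_below:
  fixes F :: "'a::euclidean_space \<Rightarrow> real"
  assumes F: "convex_on S F" and y: "y \<in> interior S" and u: "u \<in> S" and g: "GDERIV F y :> g"
  shows "F y + g \<bullet> (u - y) \<le> F u"
proof -
  define l where "l = (\<lambda>r::real. y + r *\<^sub>R (u - y))"
  define A where "A = l -` S"
  have l: "l ((1 - a) *\<^sub>R p + a *\<^sub>R q) = (1 - a) *\<^sub>R l p + a *\<^sub>R l q" for a p q
    by (simp add: l_def algebra_simps)
  have S: "convex S" using F by (rule convex_on_imp_convex)
  have A: "convex A"
    unfolding convex_alt A_def using S l by (simp add: convex_alt)
  have "convex_on A (F \<circ> l)"
  proof (rule convex_onI)
    fix r p q :: real assume "0 < r" "r < 1" "p \<in> A" "q \<in> A"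
    then show "(F \<circ> l) ((1 - r) *\<^sub>R p + r *\<^sub>R q) \<le> (1 - r) * (F \<circ> l) p + r * (F \<circ> l) q"
      using convex_onD[OF F, of r "l p" "l q"] l[of r p q] by (simp add: A_def)
  qed (rule A)
  moreover have "0 \<in> interior A"
  proof -
    have "open (l -` interior S)"
      by (rule open_vimage) (auto simp: l_def intro!: continuous_intros)
    moreover have "0 \<in> l -` interior S" using y by (simp add: l_def)
    moreover have "l -` interior S \<subseteq> A" using interior_subset by (auto simp: A_def)
    ultimately show ?thesis by (meson interiorI)
  qed
  moreover have "1 \<in> A" using u by (simp add: A_def l_def)
  moreover have "(F \<circ> l has_field_derivative g \<bullet> (u - y)) (at 0 within A)"
  proof -
    have "(l has_derivative (\<lambda>r. r *\<^sub>R (u - y))) (at 0)"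
      unfolding l_def by (auto intro!: derivative_eq_intros)
    moreover have "(F has_derivative (\<lambda>h. h \<bullet> g)) (at (l 0))"
      using g by (simp add: l_def gderiv_def)
    ultimately have "(F \<circ> l has_derivative (\<lambda>h. h \<bullet> g) \<circ> (\<lambda>r. r *\<^sub>R (u - y))) (at 0)"
      by (rule diff_chain_at)
    moreover have "(\<lambda>h. h \<bullet> g) \<circ> (\<lambda>r. r *\<^sub>R (u - y)) = (*) (g \<bullet> (u - y))"
      by (auto simp: inner_commute)
    ultimately show ?thesis
      unfolding has_field_derivative_def by (metis has_derivative_at_withinI)
  qed
  ultimately have "(F \<circ> l) 1 - (F \<circ> l) 0 \<ge> g \<bullet> (u - y) * (1 - 0)"
    using convex_connected[OF A] by (intro convex_on_imp_above_tangent)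
  then show ?thesis by (simp add: l_def)
qed

section \<open>Bregman divergences and proximal steps\<close>

text \<open>Real-valued counterpart of \<open>bregman\<close>. The two agree on the domain of
  \<open>d\<close>, so the identities can be proved by ring arithmetic instead of in the extended
  reals.\<close>

definition rbregman :: "('a::euclidean_space \<Rightarrow> ereal) \<Rightarrow> 'a \<Rightarrow> 'a \<Rightarrow> real"
  where "rbregman d x y = rval d x - rval d y - grad (rval d) y \<bullet> (x - y)"

lemma rbregman_self [simp]: "rbregman d x x = 0"
  by (simp add: rbregman_def)

lemma rbregman_three_point:
  "rbregman d u x = rbregman d y x + (grad (rval d) y - grad (rval d) x) \<bullet> (u - y) + rbregman d u y"
  by (simp add: rbregman_def algebra_simps)

context
  fixes d :: "'a::euclidean_space \<Rightarrow> ereal"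
  assumes d: "legendre d"
begin

lemma legendre_ereal_rval: "u \<in> edom d \<Longrightarrow> d u = ereal (rval d u)"
  using d by (cases "d u") (auto simp: legendre_def edom_def rval_def)

lemma legendre_infinity: "u \<notin> edom d \<Longrightarrow> d u = \<infinity>"
  by (auto simp: edom_def)

lemma legendre_convex_edom: "convex (edom d)"
  using d convex_on_imp_convex by (auto simp: legendre_def)

lemma legendre_GDERIV:
  assumes "x \<in> interior (edom d)"
  shows "GDERIV (rval d) x :> grad (rval d) x"
  using d assms by (intro GDERIV_grad)
    (auto simp: legendre_def differentiable_on_eq_differentiable_at)

lemma bregman_eq_ereal:
  "u \<in> edom d \<Longrightarrow> y \<in> edom d \<Longrightarrow> bregman d u y = ereal (rbregman d u y)"
  by (simp add: bregman_def rbregman_def legendre_ereal_rval)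

lemma bregman_eq_infinity:
  "u \<notin> edom d \<Longrightarrow> y \<in> edom d \<Longrightarrow> bregman d u y = \<infinity>"
  by (simp add: bregman_def legendre_ereal_rval legendre_infinity)

lemma GDERIV_rbregman:
  assumes "x \<in> interior (edom d)"
  shows "GDERIV (\<lambda>u. rbregman d u y) x :> grad (rval d) x - grad (rval d) y"
proof -
  have "GDERIV (\<lambda>u. rval d u - rval d y - (grad (rval d) y \<bullet> u - grad (rval d) y \<bullet> y)) x
      :> grad (rval d) x - 0 - (grad (rval d) y - 0)"
    by (intro GDERIV_diff GDERIV_const GDERIV_inner legendre_GDERIV assms)
  then show ?thesis by (simp add: rbregman_def inner_diff_right)
qed

lemma phi_eq_ereal:
  "u \<in> edom d \<Longrightarrow> x0 \<in> edom d \<Longrightarrow> phi d f \<mu> x0 u = ereal (f u + \<mu> * rbregman d u x0)"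
  by (simp add: phi_def bregman_eq_ereal)

lemma grad_phi:
  assumes "x0 \<in> edom d" and y: "y \<in> interior (edom d)" and f: "GDERIV f y :> g"
  shows "grad (rval (phi d f \<mu> x0)) y = g + \<mu> *\<^sub>R (grad (rval d) y - grad (rval d) x0)"
proof (rule grad_eqI)
  have "GDERIV (\<lambda>u. f u + \<mu> * rbregman d u x0) y
      :> g + \<mu> *\<^sub>R (grad (rval d) y - grad (rval d) x0)"
    by (intro GDERIV_add f GDERIV_cmult GDERIV_rbregman y)
  then show "GDERIV (rval (phi d f \<mu> x0)) y :> g + \<mu> *\<^sub>R (grad (rval d) y - grad (rval d) x0)"
    using open_interior y
  \<comment> \<open>\<open>rval\<close> sends infinite values to a default, so the two functions
    need agree only on the domain; the open interior around \<open>y\<close> is enough for the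
    gradient.\<close>
  proof (rule GDERIV_transform_open)
    fix u assume "u \<in> interior (edom d)"
    then have "u \<in> edom d" using interior_subset by auto
    then show "f u + \<mu> * rbregman d u x0 = rval (phi d f \<mu> x0) u"
      using assms(1) by (simp add: rval_def phi_eq_ereal)
  qed
qed

lemma bregman_prox_le:
  assumes z: "bregman_prox d g c y z" and "0 < c" "y \<in> edom d" "u \<in> closure (edom d)"
  shows "ereal (g \<bullet> z + c * rbregman d z y) \<le> ereal (g \<bullet> u) + ereal c * bregman d u y"
proof -
  have "z \<in> edom d" using z interior_subset by (auto simp: bregman_prox_def)
  then have "ereal (g \<bullet> z + c * rbregman d z y) = ereal (g \<bullet> z) + ereal c * bregman d z y"
    using assms by (simp add: bregman_eq_ereal)
  also have "\<dots> \<le> ereal (g \<bullet> u) + ereal c * bregman d u y"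
    using z \<open>u \<in> closure (edom d)\<close>
    unfolding bregman_prox_def is_minimizer_def is_arg_min_def by (meson not_less)
  finally show ?thesis .
qed

text \<open>As \<open>z\<close> is interior, optimality means stationarity: \<open>g\<close> is
  \<open>c\<close> times the difference of the gradients of \<open>d\<close> at \<open>y\<close> and
  at \<open>z\<close>. The three-point identity then gives an equality, not just an
  inequality.\<close>

lemma bregman_prox_three_point:
  assumes z: "bregman_prox d g c y z" and "0 < c" and y: "y \<in> edom d"
  shows "g \<bullet> u + c * rbregman d u y = g \<bullet> z + c * rbregman d z y + c * rbregman d u z"
proof -
  have zi: "z \<in> interior (edom d)" using z by (simp add: bregman_prox_def)
  have "GDERIV (\<lambda>u. g \<bullet> u + c * rbregman d u y) z :> g + c *\<^sub>R (grad (rval d) z - grad (rval d) y)"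
    by (intro GDERIV_add GDERIV_inner GDERIV_cmult GDERIV_rbregman zi)
  moreover have "g \<bullet> z + c * rbregman d z y \<le> g \<bullet> u + c * rbregman d u y"
    if "u \<in> interior (edom d)" for u
  proof -
    have "u \<in> edom d" using that interior_subset by auto
    then show ?thesis
      using bregman_prox_le[OF assms, of u] closure_subset[of "edom d"] y
      by (auto simp: bregman_eq_ereal)
  qed
  ultimately have "g + c *\<^sub>R (grad (rval d) z - grad (rval d) y) = 0"
    using zi by (rule_tac GDERIV_min_zero[OF _ open_interior])
  then have g: "g = c *\<^sub>R (grad (rval d) y - grad (rval d) z)"
    by (simp add: algebra_simps add_eq_0_iff)
  show ?thesis
    unfolding g
    by (subst rbregman_three_point[of d u y z]) (simp add: algebra_simps)
qed

text \<open>The three-point identity recombines all \<open>\<mu>\<close>-terms of the model into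
  \<open>\<mu>\<close> times the divergence from \<open>x0\<close>: only \<open>f\<close> is really
  linearized, the regularizer is reproduced exactly.\<close>

lemma bregman_model_eq:
  assumes x0: "x0 \<in> edom d" and y: "y \<in> interior (edom d)" and u: "u \<in> edom d"
    and f: "GDERIV f y :> g"
  shows "phi d f \<mu> x0 y + ereal (grad (rval (phi d f \<mu> x0)) y \<bullet> (u - y)) + ereal \<mu> * bregman d u y
    = ereal (f y + g \<bullet> (u - y) + \<mu> * rbregman d u x0)"
proof -
  have "y \<in> edom d" using y interior_subset by auto
  then show ?thesis
    using x0 u
    by (subst rbregman_three_point[of d u x0 y])
      (simp add: grad_phi[OF x0 y f] phi_eq_ereal bregman_eq_ereal algebra_simps)
qed

text \<open>Optimality of \<open>z\<close> bounds the left side by the same model at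
  \<open>u\<close>, whose affine part is below \<open>f\<close>. For \<open>u\<close> outside the
  domain the right side is infinite since \<open>0 < c\<close>; \<open>\<mu> = 0\<close> is treated
  apart there because \<open>0 * \<infinity> = 0\<close>.\<close>

lemma bregman_prox_estimate:
  assumes z: "bregman_prox d g (\<mu> + c) x0 z" and "0 \<le> \<mu>" "0 < c" and x0: "x0 \<in> edom d"
    and below: "\<And>u. u \<in> closure (edom d) \<Longrightarrow> a + g \<bullet> u \<le> f u"
    and u: "u \<in> closure (edom d)"
  shows "ereal (a + g \<bullet> z + (\<mu> + c) * rbregman d z x0)
    \<le> phi d f \<mu> x0 u + ereal c * bregman d u x0"
proof (cases "u \<in> edom d")
  case True
  then have "g \<bullet> z + (\<mu> + c) * rbregman d z x0 \<le> g \<bullet> u + (\<mu> + c) * rbregman d u x0"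
    using bregman_prox_le[OF z _ x0 u] assms by (simp add: bregman_eq_ereal)
  then show ?thesis
    using True x0 below[OF u] by (simp add: phi_eq_ereal bregman_eq_ereal algebra_simps)
next
  case False
  then show ?thesis
    using x0 assms by (cases "\<mu> = 0") (auto simp: phi_def bregman_eq_infinity)
qed

end

section \<open>Runs of the algorithm\<close>

text \<open>Doubling a nonnegative estimate never lowers it, so the bound \<open>\<mu>\<close> on
  the smoothness estimate survives every trial.\<close>

lemma backtrack_ge:
  assumes "backtrack d \<phi> y L L' x" "0 \<le> L"
  shows "L \<le> L' \<and> bregman_prox d (grad (rval \<phi>) y) L' y x"
  using assms by induction auto

text \<open>Everything follows from \<open>q \<le> sqrt (\<mu> / M) \<le> t\<close> and
  \<open>sqrt (\<mu> / M) < 1\<close>; the first bound replaces \<open>L\<close> by its lower bound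
  \<open>\<mu>\<close>.\<close>

lemma extrapolation_weight_bounds:
  fixes \<mu> M L t :: real
  assumes "0 \<le> \<mu>" "\<mu> < M" "\<mu> \<le> L" "0 < t" "t \<le> 1" "\<mu> \<le> M * t\<^sup>2"
  defines "q \<equiv> \<mu> / sqrt (M * L)"
  shows "0 \<le> (t - q) / (1 - q)" "(t - q) / (1 - q) \<le> 1"
proof -
  have q: "q \<le> sqrt (\<mu> / M)"
  proof (cases "\<mu> = 0")
    case False
    have "q \<le> \<mu> / sqrt (M * \<mu>)"
      unfolding q_def using assms False by (intro divide_left_mono) auto
    also have "\<dots> = sqrt (\<mu> / M)"
      using assms False by (simp add: real_sqrt_mult real_sqrt_divide field_simps)
    finally show ?thesis .
  qed (simp add: q_def)
  have "\<mu> / M \<le> t\<^sup>2" "\<mu> / M < 1" using assms by (simp_all add: field_simps)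
  then have "sqrt (\<mu> / M) \<le> t" "sqrt (\<mu> / M) < 1"
    using assms by (simp_all add: real_le_lsqrt)
  with q have "q \<le> t" "q < 1" by linarith+
  with \<open>t \<le> 1\<close> show "0 \<le> (t - q) / (1 - q)" "(t - q) / (1 - q) \<le> 1" by auto
qed

text \<open>Describes working states of the inner loop, because a rejected trial may also change the
  smoothness estimate and improve the best point. \<open>b\<close> stands for the best value at the
  start of the iteration.\<close>

definition abra_invariant ::
  "('a::euclidean_space \<Rightarrow> ereal) \<Rightarrow> ('a \<Rightarrow> real) \<Rightarrow> real \<Rightarrow> 'a \<Rightarrow> ereal \<Rightarrow> 'a abra_state \<Rightarrow> bool"
  where "abra_invariant d f \<mu> x0 b r \<longleftrightarrow>
    \<mu> \<le> st_L r \<and> st_best r \<le> b \<and> st_xbest r \<in> interior (edom d) \<and>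
    st_best r = phi d f \<mu> x0 (st_xbest r)"

lemma abra_trial_cases:
  assumes "abra_trial d f \<mu> x0 k s q r"
  obtains y \<tau> x where
    "\<tau> = (st_t r - \<mu> / sqrt (st_M r * st_L q)) / (1 - \<mu> / sqrt (st_M r * st_L q))"
    "y = (1 - \<tau>) *\<^sub>R st_xbest s + \<tau> *\<^sub>R st_z s"
    "st_low r = phi d f \<mu> x0 y + ereal (grad (rval (phi d f \<mu> x0)) y \<bullet> (st_z s - y))
      + ereal \<mu> * bregman d (st_z s) y"
    "backtrack d (phi d f \<mu> x0) y (st_L q) (st_L r) x"
    "st_lam r = (1 - st_t r) *\<^sub>R st_lam s + st_t r *\<^sub>R grad f y"
    "bregman_prox d (st_lam r) (\<mu> + 1 / st_eta r) x0 (st_z r)"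
    "st_xbest r = (if st_best q > phi d f \<mu> x0 x then x else st_xbest q)"
    "st_best r = (if st_best q > phi d f \<mu> x0 x then phi d f \<mu> x0 x else st_best q)"
  using assms unfolding abra_trial_def Let_def by auto

lemma abra_trial_invariant:
  assumes "abra_trial d f \<mu> x0 k s q r" "0 \<le> \<mu>" "abra_invariant d f \<mu> x0 b q"
  shows "abra_invariant d f \<mu> x0 b r"
  using assms(1)
proof (cases rule: abra_trial_cases)
  case (1 y \<tau> x)
  with backtrack_ge[OF 1(4)] assms(2,3) show ?thesis
    by (auto simp: abra_invariant_def bregman_prox_def)
qed

text \<open>Rejected trials preserve the invariant, so induction along the loop reaches a working
  state \<open>q\<close> from which the accepted trial starts.\<close>

lemma abra_inner_accepted:
  assumes "abra_inner d f \<mu> x0 k s q r" "0 \<le> \<mu>" "abra_invariant d f \<mu> x0 b q"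
  shows "\<exists>q. abra_invariant d f \<mu> x0 b q \<and> abra_trial d f \<mu> x0 k s q r \<and> abra_exit d \<mu> s r"
  using assms by induction (auto intro: abra_trial_invariant)

text \<open>
  The hypotheses on the old model carry the factor \<open>1 - t\<close>, so that they hold trivially in
  iteration \<open>0\<close>, where \<open>t = 1\<close> and there is no old model.
\<close>

lemma abra_estimate_step:
  fixes d :: "'a::euclidean_space \<Rightarrow> ereal"
  assumes d: "legendre d" and x0: "x0 \<in> interior (edom d)"
    and convex: "convex_on (closure (edom d)) f"
    and diff: "f differentiable_on interior (closure (edom d))"
    and trial: "abra_trial d f \<mu> x0 k s q r" and exit: "abra_exit d \<mu> s r"
    and q: "\<mu> \<le> st_L q"
    and xbest: "st_xbest s \<in> interior (edom d)" and z: "st_z s \<in> interior (edom d)"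
    and b: "st_best s = ereal b"
    and \<mu>: "0 \<le> \<mu>" "\<mu> < st_M r" and t: "0 < st_t r" "st_t r \<le> 1"
    and \<eta>: "0 < 1 / st_eta r" "\<mu> + 1 / st_eta r = st_M r * (st_t r)\<^sup>2"
    and below: "\<And>u. u \<in> closure (edom d) \<Longrightarrow>
      (1 - st_t r) * (a + st_lam s \<bullet> u) \<le> (1 - st_t r) * f u"
    and best: "(1 - st_t r) * b \<le> (1 - st_t r) * (a + st_lam s \<bullet> st_z s)
      + (\<mu> + 1 / st_eta r - st_t r * \<mu>) * rbregman d (st_z s) x0"
  shows "\<exists>a'. (\<forall>u\<in>closure (edom d). a' + st_lam r \<bullet> u \<le> f u) \<and>
    st_best r \<le> ereal (a' + st_lam r \<bullet> st_z r + (\<mu> + 1 / st_eta r) * rbregman d (st_z r) x0)"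
  using trial
proof (cases rule: abra_trial_cases)
  case (1 y \<tau> x)
  define t where "t = st_t r"
  define c where "c = \<mu> + 1 / st_eta r"
  define z' where "z' = st_z s"
  define zn where "zn = st_z r"
  note defs = t_def [symmetric] c_def [symmetric] z'_def [symmetric] zn_def [symmetric]
  \<comment> \<open>With the weight in the unit interval, \<open>y\<close> is a convex combination
    of two interior points, so the gradients at \<open>y\<close> exist.\<close>
  have "0 \<le> \<tau>" "\<tau> \<le> 1"
    using extrapolation_weight_bounds[of \<mu> "st_M r" "st_L q" "st_t r"] q \<mu> t \<eta> 1(1) by auto
  then have y: "y \<in> interior (edom d)"
    using convex_interior[OF legendre_convex_edom[OF d]] xbest z
    unfolding 1(2) convex_alt by blast
  have y': "y \<in> interior (closure (edom d))"
    using y interior_mono[OF closure_subset] by blast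
  then have g: "GDERIV f y :> grad f y"
    using diff by (auto intro!: GDERIV_grad simp: differentiable_on_eq_differentiable_at)
  have prox: "bregman_prox d (st_lam r) c x0 zn"
    using 1(6) by (simp add: defs)
  have edom: "x0 \<in> edom d" "z' \<in> edom d" "zn \<in> edom d"
    using x0 z prox interior_subset by (auto simp: bregman_prox_def z'_def)
  have c: "0 < c" unfolding c_def using \<eta>(1) \<mu>(1) by linarith
  \<comment> \<open>The constant part of the new affine minorant; its linear part is
    \<open>st_lam r\<close>.\<close>
  define a' where "a' = (1 - t) * a + t * (f y - grad f y \<bullet> y)"
  have split: "a' + st_lam r \<bullet> u
      = (1 - t) * (a + st_lam s \<bullet> u) + t * (f y + grad f y \<bullet> (u - y))" for u
    by (simp add: a'_def 1(5) defs algebra_simps)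
  have low: "st_low r = ereal (f y + grad f y \<bullet> (z' - y) + \<mu> * rbregman d z' x0)"
    using 1(3) bregman_model_eq[OF d edom(1) y edom(2) g] by (simp add: defs)
  show ?thesis
  proof (intro exI[of _ a'] conjI ballI)
    fix u assume u: "u \<in> closure (edom d)"
    have "t * (f y + grad f y \<bullet> (u - y)) \<le> t * f u"
      using convex_on_gradient_below[OF convex y' u g] \<open>0 < st_t r\<close>
      by (intro mult_left_mono) (auto simp: t_def)
    with below[OF u] show "a' + st_lam r \<bullet> u \<le> f u"
      unfolding split by (simp add: defs algebra_simps)
  next
    have "st_best r \<le> ereal (1 - t) * st_best s + ereal t * st_low r - ereal c * bregman d z' zn"
      using exit by (simp add: abra_exit_def defs)
    also have "\<dots> = ereal ((1 - t) * b
        + t * (f y + grad f y \<bullet> (z' - y) + \<mu> * rbregman d z' x0) - c * rbregman d z' zn)"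
      using edom by (simp add: b low bregman_eq_ereal[OF d])
    \<comment> \<open>The hypothesis \<open>best\<close> contributes the coefficient
      \<open>c - t * \<mu>\<close> of the divergence of \<open>z'\<close> from \<open>x0\<close>,
      the lower model contributes \<open>t * \<mu>\<close>; together they give
      \<open>c\<close>.\<close>
    also have "\<dots> \<le> ereal (a' + st_lam r \<bullet> z' + c * rbregman d z' x0 - c * rbregman d z' zn)"
      using best unfolding split by (simp add: defs algebra_simps)
    \<comment> \<open>The divergence subtracted in the exit test is exactly the excess of the new
      model at \<open>z'\<close> over its value at the minimizer \<open>zn\<close>.\<close>
    also have "\<dots> = ereal (a' + st_lam r \<bullet> zn + c * rbregman d zn x0)"
      using bregman_prox_three_point[OF d prox c edom(1), of z'] by simp
    finally show "st_best r \<le> ereal (a' + st_lam r \<bullet> st_z r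
        + (\<mu> + 1 / st_eta r) * rbregman d (st_z r) x0)"
      by (simp add: defs)
  qed
qed

text \<open>The two conclusions alternate in one induction: interior points in \<open>s k\<close>
  give the invariant at the start of the inner loop, and the accepted trial puts the points of
  \<open>s (Suc k)\<close> in the interior. The \<open>max\<close> in \<open>abra_prepare\<close>
  supplies the bound \<open>\<mu>\<close>.\<close>

lemma abra_run_interior:
  assumes run: "abra_run d f \<mu> x0 L0 Minit s" and \<mu>: "0 \<le> \<mu>" and x0: "x0 \<in> interior (edom d)"
  shows "st_xbest (s k) \<in> interior (edom d) \<and> st_z (s k) \<in> interior (edom d) \<and>
    st_best (s k) = phi d f \<mu> x0 (st_xbest (s k))"
    and "\<exists>q. abra_invariant d f \<mu> x0 (st_best (s k)) q \<and>
      abra_trial d f \<mu> x0 k (s k) q (s (Suc k)) \<and> abra_exit d \<mu> (s k) (s (Suc k))"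
proof -
  let ?I = "\<lambda>k. st_xbest (s k) \<in> interior (edom d) \<and> st_z (s k) \<in> interior (edom d) \<and>
    st_best (s k) = phi d f \<mu> x0 (st_xbest (s k))"
  have accepted: "\<exists>q. abra_invariant d f \<mu> x0 (st_best (s k)) q \<and>
      abra_trial d f \<mu> x0 k (s k) q (s (Suc k)) \<and> abra_exit d \<mu> (s k) (s (Suc k))"
    if "?I k" for k
    using run that
    by (intro abra_inner_accepted[OF _ \<mu>])
      (auto simp: abra_run_def abra_invariant_def abra_prepare_def)
  have I: "?I k" for k
  proof (induction k)
    case 0
    then show ?case using run x0 by (simp add: abra_run_def abra_init_def)
  next
    case (Suc k)
    then obtain q where q: "abra_invariant d f \<mu> x0 (st_best (s k)) q"
      and trial: "abra_trial d f \<mu> x0 k (s k) q (s (Suc k))"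
      using accepted by blast
    have "st_z (s (Suc k)) \<in> interior (edom d)"
      using trial by (cases rule: abra_trial_cases) (simp add: bregman_prox_def)
    with abra_trial_invariant[OF trial \<mu> q] show ?case
      by (simp add: abra_invariant_def)
  qed
  show "?I k" by (rule I)
  show "\<exists>q. abra_invariant d f \<mu> x0 (st_best (s k)) q \<and>
      abra_trial d f \<mu> x0 k (s k) q (s (Suc k)) \<and> abra_exit d \<mu> (s k) (s (Suc k))"
    using I by (rule accepted)
qed

lemma abra_run_decreasing:
  assumes "abra_run d f \<mu> x0 L0 Minit s" "0 \<le> \<mu>" "x0 \<in> interior (edom d)"
  shows "st_best (s (Suc k)) \<le> st_best (s k)"
proof -
  obtain q where "abra_invariant d f \<mu> x0 (st_best (s k)) q"
    "abra_trial d f \<mu> x0 k (s k) q (s (Suc k))"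
    using abra_run_interior(2)[OF assms] by blast
  then have "abra_invariant d f \<mu> x0 (st_best (s k)) (s (Suc k))"
    using abra_trial_invariant assms(2) by blast
  then show ?thesis unfolding abra_invariant_def by (elim conjE)
qed

lemma abra_run_estimate:
  assumes d: "legendre d" and x0: "x0 \<in> interior (edom d)" and \<mu>: "0 \<le> \<mu>"
    and convex: "convex_on (closure (edom d)) f"
    and diff: "f differentiable_on interior (closure (edom d))"
    and run: "abra_run d f \<mu> x0 L0 Minit s"
    and M: "\<And>k. \<mu> < st_M (s (Suc k))"
    and t: "\<And>k. 0 < st_t (s (Suc k)) \<and> st_t (s (Suc k)) \<le> 1"
    and Mt: "\<And>k. \<mu> + 1 / st_eta (s (Suc k)) = st_M (s (Suc k)) * (st_t (s (Suc k)))\<^sup>2"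
    and pos: "\<And>k. 0 < 1 / st_eta (s (Suc k))"
    and \<eta>: "\<And>k. 1 \<le> k \<Longrightarrow> 1 / st_eta (s (Suc k)) = (1 - st_t (s (Suc k))) * (1 / st_eta (s k))"
    and t0: "st_t (s 1) = 1"
    and u: "u \<in> closure (edom d)"
  shows "st_best (s (Suc k)) \<le> phi_reg d f \<mu> x0 (st_eta (s (Suc k))) u"
proof -
  note I = abra_run_interior[OF run \<mu> x0]
  have edom: "x0 \<in> edom d" using x0 interior_subset by blast
  have best: "\<exists>b. st_best (s k) = ereal b" for k
  proof -
    have "st_xbest (s k) \<in> edom d" "st_best (s k) = phi d f \<mu> x0 (st_xbest (s k))"
      using I(1)[of k] interior_subset by blast+
    then show ?thesis using phi_eq_ereal[OF d _ edom] by simp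
  qed
  have "\<exists>a. (\<forall>u\<in>closure (edom d). a + st_lam (s (Suc k)) \<bullet> u \<le> f u) \<and>
    st_best (s (Suc k)) \<le> ereal (a + st_lam (s (Suc k)) \<bullet> st_z (s (Suc k))
      + (\<mu> + 1 / st_eta (s (Suc k))) * rbregman d (st_z (s (Suc k))) x0)"
  proof (induction k)
    case 0
    obtain q where "abra_invariant d f \<mu> x0 (st_best (s 0)) q"
      and trial: "abra_trial d f \<mu> x0 0 (s 0) q (s (Suc 0))"
      and exit: "abra_exit d \<mu> (s 0) (s (Suc 0))"
      using I(2)[of 0] by blast
    then have q: "\<mu> \<le> st_L q" by (simp add: abra_invariant_def)
    obtain b where b: "st_best (s 0) = ereal b" using best by blast
    have z0: "st_z (s 0) = x0" using run by (simp add: abra_run_def abra_init_def)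
    \<comment> \<open>As \<open>t = 1\<close>, all terms with the factor \<open>1 - t\<close> vanish
      and any \<open>a\<close> would do. What remains of \<open>best\<close> is a multiple of the
      divergence of \<open>x0\<close> from itself, which is zero.\<close>
    show ?case
      using t0 z0 I(1)[of 0]
      by (intro abra_estimate_step[OF d x0 convex diff trial exit q _ _ b \<mu> M _ _ pos Mt,
          where a = 0]) simp_all
  next
    case (Suc k)
    let ?s = "s (Suc k)" and ?r = "s (Suc (Suc k))"
    obtain q where "abra_invariant d f \<mu> x0 (st_best ?s) q"
      and trial: "abra_trial d f \<mu> x0 (Suc k) ?s q ?r" and exit: "abra_exit d \<mu> ?s ?r"
      using I(2)[of "Suc k"] by blast
    then have q: "\<mu> \<le> st_L q" by (simp add: abra_invariant_def)
    obtain b where b: "st_best ?s = ereal b" using best by blast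
    from Suc.IH obtain a where below: "\<And>u. u \<in> closure (edom d) \<Longrightarrow> a + st_lam ?s \<bullet> u \<le> f u"
      and a: "b \<le> a + st_lam ?s \<bullet> st_z ?s + (\<mu> + 1 / st_eta ?s) * rbregman d (st_z ?s) x0"
      unfolding b by auto
    \<comment> \<open>The recurrence for \<open>1/\<eta>\<close> makes the coefficient left for the
      old model exactly \<open>1 - t\<close> times its own, so the induction hypothesis scaled by
      \<open>1 - t\<close> fits.\<close>
    have c: "\<mu> + 1 / st_eta ?r - st_t ?r * \<mu> = (1 - st_t ?r) * (\<mu> + 1 / st_eta ?s)"
      using \<eta>[of "Suc k"] by (simp only: algebra_simps)
    have "(1 - st_t ?r) * b \<le> (1 - st_t ?r) * (a + st_lam ?s \<bullet> st_z ?s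
        + (\<mu> + 1 / st_eta ?s) * rbregman d (st_z ?s) x0)"
      using a t[of "Suc k"] by (intro mult_left_mono) auto
    then have "(1 - st_t ?r) * b \<le> (1 - st_t ?r) * (a + st_lam ?s \<bullet> st_z ?s)
        + (\<mu> + 1 / st_eta ?r - st_t ?r * \<mu>) * rbregman d (st_z ?s) x0"
      unfolding c by (simp only: distrib_left [of "1 - st_t ?r" "_ + _ \<bullet> _"] mult.assoc)
    then show ?case
      using t[of "Suc k"] I(1)[of "Suc k"]
      by (intro abra_estimate_step[OF d x0 convex diff trial exit q _ _ b \<mu> M _ _ pos Mt,
          where a = a]) (simp_all add: below mult_left_mono)
  qed
  then obtain a where below: "\<And>u. u \<in> closure (edom d) \<Longrightarrow> a + st_lam (s (Suc k)) \<bullet> u \<le> f u"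
    and a: "st_best (s (Suc k)) \<le> ereal (a + st_lam (s (Suc k)) \<bullet> st_z (s (Suc k))
      + (\<mu> + 1 / st_eta (s (Suc k))) * rbregman d (st_z (s (Suc k))) x0)"
    by blast
  have "bregman_prox d (st_lam (s (Suc k))) (\<mu> + 1 / st_eta (s (Suc k))) x0 (st_z (s (Suc k)))"
  proof -
    obtain q where "abra_trial d f \<mu> x0 k (s k) q (s (Suc k))" using I(2)[of k] by blast
    then show ?thesis by (cases rule: abra_trial_cases)
  qed
  from a bregman_prox_estimate[OF d this \<mu> pos edom below u] show ?thesis
    unfolding phi_reg_def by (rule order_trans)
qed

section \<open>Rates for the weights\<close>

text \<open>Since \<open>sqrt ((1 - t) * A) = t * sqrt M\<close>, dividing the loss
  \<open>t / 2\<close> by it cancels \<open>t\<close> and leaves the increment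
  \<open>1 / (2 * sqrt M)\<close>.\<close>

lemma inverse_sqrt_step:
  fixes A M t :: real
  assumes "0 < A" "0 < M" "0 < t" "t < 1" "(1 - t) * A = M * t\<^sup>2"
  shows "1 / sqrt A + 1 / (2 * sqrt M) \<le> 1 / sqrt ((1 - t) * A)"
proof -
  have s: "sqrt (1 - t) \<le> 1 - t / 2"
    by (rule real_le_lsqrt) (use assms in \<open>auto simp: power2_eq_square algebra_simps\<close>)
  have B: "sqrt ((1 - t) * A) = t * sqrt M"
    using assms by (simp add: real_sqrt_mult)
  have "1 / sqrt A = sqrt (1 - t) / sqrt ((1 - t) * A)"
    using assms(1-4) by (simp add: real_sqrt_mult)
  also have "\<dots> \<le> (1 - t / 2) / (t * sqrt M)"
    unfolding B using s assms by (intro divide_right_mono) auto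
  also have "\<dots> = 1 / (t * sqrt M) - 1 / (2 * sqrt M)"
    using assms by (simp add: field_simps)
  finally show ?thesis using B by simp
qed

text \<open>Telescoped from a free index \<open>K\<close>: the sum rate starts at \<open>1\<close>,
  past the exceptional \<open>t 0 = 1\<close>, and the sublinear rate at the index where the bound
  on \<open>M\<close> begins.\<close>

lemma inverse_sqrt_growth:
  fixes A M t :: "nat \<Rightarrow> real"
  assumes "\<And>k. K \<le> k \<Longrightarrow> 0 < A k" "\<And>k. K \<le> k \<Longrightarrow> 0 < M k"
    and "\<And>k. K \<le> k \<Longrightarrow> 0 < t k \<and> t k < 1"
    and "\<And>k. K \<le> k \<Longrightarrow> A (Suc k) = M k * (t k)\<^sup>2"
    and "\<And>k. K \<le> k \<Longrightarrow> A (Suc k) = (1 - t k) * A k"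
    and "K \<le> k"
  shows "1 / sqrt (A K) + (\<Sum>i=K..<k. 1 / sqrt (M i)) / 2 \<le> 1 / sqrt (A k)"
  using \<open>K \<le> k\<close>
proof (induction k rule: dec_induct)
  case (step k)
  have "1 / sqrt (A k) + 1 / (2 * sqrt (M k)) \<le> 1 / sqrt (A (Suc k))"
    using inverse_sqrt_step[of "A k" "M k" "t k"] assms(1-5)[of k] step.hyps by simp
  with step show ?case by (simp add: add_divide_distrib)
qed simp

lemma le_inverse_square_if_inverse_sqrt_ge:
  fixes A S :: real
  assumes "0 < A" "0 < S" "S \<le> 1 / sqrt A"
  shows "A \<le> 1 / S\<^sup>2"
proof -
  have "S\<^sup>2 \<le> (1 / sqrt A)\<^sup>2" using assms by (intro power_mono) auto
  then show ?thesis using assms by (simp add: power_divide field_simps)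
qed

lemma geometric_decay:
  fixes A M t :: "nat \<Rightarrow> real"
  assumes "0 \<le> \<mu>" and "\<And>k. K \<le> k \<Longrightarrow> 0 < A k" "\<And>k. K \<le> k \<Longrightarrow> \<mu> < M k"
    and "\<And>k. K \<le> k \<Longrightarrow> 0 < t k"
    and "\<And>k. K \<le> k \<Longrightarrow> \<mu> + A (Suc k) = M k * (t k)\<^sup>2"
    and "\<And>k. K \<le> k \<Longrightarrow> A (Suc k) = (1 - t k) * A k"
    and "K \<le> k"
  shows "A k \<le> A K * (\<Prod>i=K..<k. 1 - sqrt (\<mu> / M i))"
  using \<open>K \<le> k\<close>
proof (induction k rule: dec_induct)
  case (step k)
  have M: "\<mu> < M k" "0 < t k" using assms step.hyps by auto
  \<comment> \<open>Positivity of the next weight \<open>A (Suc k)\<close> is what gives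
    \<open>M k * (t k)\<^sup>2\<close> the lower bound \<open>\<mu>\<close>.\<close>
  have "\<mu> / M k \<le> (t k)\<^sup>2"
    using assms(2)[of "Suc k"] assms(5)[of k] step.hyps M \<open>0 \<le> \<mu>\<close> by (simp add: field_simps)
  then have *: "sqrt (\<mu> / M k) \<le> t k"
    using M by (simp add: real_le_lsqrt)
  have "A (Suc k) \<le> (1 - sqrt (\<mu> / M k)) * A k"
    using * assms(2)[of k] assms(6)[of k] step.hyps by (simp add: mult_right_mono)
  \<comment> \<open>The factor is nonnegative because \<open>\<mu> < M k\<close>, so it may multiply
    the induction hypothesis.\<close>
  also have "\<dots> \<le> (1 - sqrt (\<mu> / M k)) * (A K * (\<Prod>i=K..<k. 1 - sqrt (\<mu> / M i)))"
    using step.IH M \<open>0 \<le> \<mu>\<close> by (intro mult_left_mono) auto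
  finally show ?case using step.hyps by (simp add: mult_ac)
qed simp

section \<open>Convergence\<close>

theorem theorem2:
  fixes d :: "'a::euclidean_space \<Rightarrow> ereal"
    and f :: "'a \<Rightarrow> real"
    and L \<mu> L0 Minit :: real
    and x0 :: 'a
    and s :: "nat \<Rightarrow> 'a abra_state"
    and M t \<eta> :: "nat \<Rightarrow> real"
    and \<phi>best :: "nat \<Rightarrow> ereal"
  assumes "legendre d"
    and "x0 \<in> interior (edom d)"
    and "0 \<le> \<mu>" and "\<mu> < L"
    and "convex_on (closure (edom d)) f"
    and "f differentiable_on interior (closure (edom d))"
    and "relatively_smooth d f (L - \<mu>)"
    and "0 < L0" and "0 < Minit"
    and "abra_run d f \<mu> x0 L0 Minit s"
    and M: "\<And>k. M k = st_M (s (Suc k))"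
    and t: "\<And>k. t k = st_t (s (Suc k))"
    and \<eta>: "\<And>k. \<eta> k = st_eta (s k)"
    and \<phi>best: "\<And>k. \<phi>best k = st_best (s k)"
    and "has_interior_minimizer d (phi d f \<mu> x0)"
    and "\<And>k. has_interior_minimizer d (phi_reg d f \<mu> x0 (\<eta> (Suc k)))"
    and "\<And>k. M k > \<mu>"
    and "\<And>k. 0 < t k \<and> t k \<le> 1"
    and "\<And>k. \<mu> + 1 / \<eta> (Suc k) = M k * (t k)\<^sup>2"
    and "\<And>k. k \<ge> 1 \<Longrightarrow> 1 / \<eta> (Suc k) = (1 - t k) * (1 / \<eta> k)"
    and "t 0 = 1"
    and "1 / \<eta> 1 = M 0 - \<mu>"
  shows "(\<forall>xstar k. is_minimizer d (phi d f \<mu> x0) xstar \<longrightarrow>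
           \<phi>best (Suc k) \<le> \<phi>best k \<and>
           \<phi>best (Suc k) \<le> min_value d (phi_reg d f \<mu> x0 (\<eta> (Suc k))) \<and>
           \<phi>best (Suc k) - min_value d (phi d f \<mu> x0) \<le> ereal (1 / \<eta> (Suc k)) * bregman d xstar x0) \<and>
         (\<mu> = 0 \<longrightarrow>
           (\<forall>k\<ge>1. 1 / \<eta> k \<le> 4 / (\<Sum>i<k. M i powr (- 1 / 2))\<^sup>2) \<and>
           (\<forall>Mbar>0. \<forall>K\<ge>1. (\<forall>i\<ge>K. M i \<le> Mbar) \<longrightarrow>
             (\<forall>k\<ge>K. 1 / \<eta> k \<le> (1 / \<eta> K) / (1 + real (k - K) / (2 * sqrt (Mbar * \<eta> K)))\<^sup>2))) \<and>
         (\<mu> > 0 \<longrightarrow>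
           (\<forall>k\<ge>1. 1 / \<eta> k \<le> (M 0 - \<mu>) * (\<Prod>i=1..<k. 1 - sqrt (\<mu> / M i))) \<and>
           (\<forall>Mbar>0. \<forall>K\<ge>1. (\<forall>i\<ge>K. M i \<le> Mbar) \<longrightarrow>
             (\<forall>k\<ge>K. 1 / \<eta> k \<le> (1 / \<eta> K) * (1 - sqrt (\<mu> / Mbar)) ^ (k - K))))"
proof -
  note x0 = assms(2) and \<mu> = assms(3) and run = assms(10)
  note M_gt = assms(17) and t_bounds = assms(18) and Mt = assms(19) and \<eta>_step = assms(20)
    and t0 = assms(21) and \<eta>1 = assms(22)
  define A where "A = (\<lambda>k. 1 / \<eta> k)"
  have A_step: "A (Suc k) = (1 - t k) * A k" if "1 \<le> k" for k
    unfolding A_def by (rule \<eta>_step[OF that])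
  have A_Mt: "\<mu> + A (Suc k) = M k * (t k)\<^sup>2" for k
    unfolding A_def by (rule Mt)
  have A1: "A 1 = M 0 - \<mu>" unfolding A_def by (rule \<eta>1)
  \<comment> \<open>If \<open>t k = 1\<close>, then \<open>A (Suc k) = 0\<close> and hence
    \<open>M k = \<mu>\<close>, a contradiction.\<close>
  have t_less: "t k < 1" if "1 \<le> k" for k
  proof (rule ccontr)
    assume "\<not> t k < 1"
    then have "t k = 1" using t_bounds[of k] by simp
    then show False using A_step[OF that] A_Mt[of k] M_gt[of k] by simp
  qed
  \<comment> \<open>The index starts at \<open>1\<close>: \<open>\<eta> 0 = 0\<close> is a
    placeholder, so \<open>A 0 = 0\<close> in HOL.\<close>
  have A_pos: "0 < A k" if "1 \<le> k" for k
    using that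
  proof (induction k rule: dec_induct)
    case base
    show ?case using A1 M_gt[of 0] by simp
  next
    case (step k)
    then show ?case using A_step[of k] t_less[of k] by simp
  qed
  have best_le: "\<phi>best (Suc k) \<le> phi_reg d f \<mu> x0 (\<eta> (Suc k)) u"
    if "u \<in> closure (edom d)" for k u
    unfolding \<phi>best \<eta>
    using M_gt t_bounds Mt A_pos \<eta>_step t0 that assms(1,5,6)
    by (intro abra_run_estimate[OF _ x0 \<mu> _ _ run]) (auto simp: M t \<eta> A_def)
  have gap: "\<phi>best (Suc k) - min_value d (phi d f \<mu> x0) \<le> ereal (1 / \<eta> (Suc k)) * bregman d xstar x0"
    if xstar: "is_minimizer d (phi d f \<mu> x0) xstar" for xstar k
  proof -
    \<comment> \<open>Interiority makes the objective and the divergence at \<open>xstar\<close>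
      finite, so the minimum can be subtracted in the extended reals.\<close>
    have int: "xstar \<in> interior (edom d)"
      using assms(15) xstar by (auto simp: has_interior_minimizer_def)
    have edom: "xstar \<in> edom d" "x0 \<in> edom d"
      using int x0 interior_subset by blast+
    have "min_value d (phi d f \<mu> x0) = phi d f \<mu> x0 xstar"
      using xstar unfolding min_value_def is_minimizer_def is_arg_min_def
      by (intro antisym INF_lower INF_greatest) (auto simp: not_less)
    moreover have "\<phi>best (Suc k) \<le> phi_reg d f \<mu> x0 (\<eta> (Suc k)) xstar"
      using edom closure_subset by (intro best_le) blast
    ultimately show ?thesis
      using phi_eq_ereal[OF assms(1) edom] bregman_eq_ereal[OF assms(1) edom]
      by (cases "\<phi>best (Suc k)") (auto simp: phi_reg_def)
  qed
  have M_pos: "0 < M k" for k using M_gt[of k] \<mu> by simp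
  have sum_rate: "1 / \<eta> k \<le> 4 / (\<Sum>i<k. M i powr (- 1 / 2))\<^sup>2"
    if "\<mu> = 0" "1 \<le> k" for k
  proof -
    have powr: "M i powr (- 1 / 2) = 1 / sqrt (M i)" for i
      using M_pos[of i] by (simp add: powr_minus_divide powr_half_sqrt)
    \<comment> \<open>The summand \<open>i = 0\<close> is not covered by the recurrence. It comes
      from the initial value \<open>A 1 = M 0\<close>, with half of it to spare.\<close>
    have split: "(\<Sum>i<k. 1 / sqrt (M i)) = 1 / sqrt (M 0) + (\<Sum>i=1..<k. 1 / sqrt (M i))"
      using \<open>1 \<le> k\<close> by (simp add: lessThan_atLeast0 sum.atLeast_Suc_lessThan)
    have "1 / sqrt (A 1) + (\<Sum>i=1..<k. 1 / sqrt (M i)) / 2 \<le> 1 / sqrt (A k)"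
      using A_pos M_pos t_bounds t_less A_Mt A_step that
      by (intro inverse_sqrt_growth[where t = t]) auto
    moreover have "1 / sqrt (M 0) / 2 \<le> 1 / sqrt (A 1)"
    proof -
      have "x / 2 \<le> x" if "0 < x" for x :: real using that by simp
      moreover have "A 1 = M 0" using A1 \<open>\<mu> = 0\<close> by simp
      ultimately show ?thesis using M_pos[of 0] by (metis real_sqrt_gt_zero zero_less_divide_1_iff)
    qed
    ultimately have "(\<Sum>i<k. 1 / sqrt (M i)) / 2 \<le> 1 / sqrt (A k)"
      unfolding split by (simp add: add_divide_distrib)
    moreover have "0 < (\<Sum>i<k. 1 / sqrt (M i))"
      using M_pos \<open>1 \<le> k\<close> by (intro sum_pos) (auto simp: lessThan_empty_iff)
    ultimately have "A k \<le> 1 / ((\<Sum>i<k. 1 / sqrt (M i)) / 2)\<^sup>2"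
      using A_pos[OF \<open>1 \<le> k\<close>] by (intro le_inverse_square_if_inverse_sqrt_ge) auto
    then show ?thesis unfolding powr A_def by (simp add: power_divide)
  qed
  have sublinear_rate:
    "1 / \<eta> k \<le> (1 / \<eta> K) / (1 + real (k - K) / (2 * sqrt (Mbar * \<eta> K)))\<^sup>2"
    if "\<mu> = 0" "0 < Mbar" "1 \<le> K" "\<forall>i\<ge>K. M i \<le> Mbar" "K \<le> k" for Mbar K k
  proof -
    have \<eta>K: "0 < \<eta> K" using A_pos[OF \<open>1 \<le> K\<close>] by (simp add: A_def)
    \<comment> \<open>The square root of the reciprocal of the target bound; with
      \<open>sqrt (\<eta> K) = 1 / sqrt (A K)\<close> it is the growth bound with every
      \<open>M i\<close> replaced by \<open>Mbar\<close>.\<close>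
    define S where "S = sqrt (\<eta> K) * (1 + real (k - K) / (2 * sqrt (Mbar * \<eta> K)))"
    have S: "S = 1 / sqrt (A K) + (\<Sum>i=K..<k. 1 / sqrt Mbar) / 2"
      using \<eta>K \<open>0 < Mbar\<close>
      by (simp add: S_def A_def real_sqrt_mult real_sqrt_divide field_simps)
    have "(\<Sum>i=K..<k. 1 / sqrt Mbar) \<le> (\<Sum>i=K..<k. 1 / sqrt (M i))"
      using that M_pos by (intro sum_mono frac_le) auto
    moreover have "1 / sqrt (A K) + (\<Sum>i=K..<k. 1 / sqrt (M i)) / 2 \<le> 1 / sqrt (A k)"
      using A_pos M_pos t_bounds t_less A_Mt A_step that
      by (intro inverse_sqrt_growth[where t = t]) auto
    ultimately have "S \<le> 1 / sqrt (A k)" unfolding S by simp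
    moreover have "0 < S" using \<eta>K \<open>0 < Mbar\<close> unfolding S_def
      by (intro mult_pos_pos add_pos_nonneg) auto
    ultimately have "A k \<le> 1 / S\<^sup>2"
      using A_pos that by (intro le_inverse_square_if_inverse_sqrt_ge) auto
    then show ?thesis
      using \<eta>K by (simp add: S_def A_def power_mult_distrib)
  qed
  \<comment> \<open>Used with \<open>K = 1\<close> for the product rate and with general
    \<open>K\<close> for the linear rate.\<close>
  have decay: "A k \<le> A K * (\<Prod>i=K..<k. 1 - sqrt (\<mu> / M i))" if "1 \<le> K" "K \<le> k" for K k
    using t_bounds that
    by (intro geometric_decay[where t = t, OF \<mu> A_pos M_gt _ A_Mt A_step]) auto
  have linear_rate: "1 / \<eta> k \<le> (1 / \<eta> K) * (1 - sqrt (\<mu> / Mbar)) ^ (k - K)"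
    if "0 < Mbar" "1 \<le> K" "\<forall>i\<ge>K. M i \<le> Mbar" "K \<le> k" for Mbar K k
  proof -
    have "(\<Prod>i=K..<k. 1 - sqrt (\<mu> / M i)) \<le> (\<Prod>i=K..<k. 1 - sqrt (\<mu> / Mbar))"
    proof (rule prod_mono)
      fix i assume "i \<in> {K..<k}"
      then have "\<mu> / Mbar \<le> \<mu> / M i"
        using that M_pos[of i] \<mu> by (intro divide_left_mono) auto
      then show "0 \<le> 1 - sqrt (\<mu> / M i) \<and> 1 - sqrt (\<mu> / M i) \<le> 1 - sqrt (\<mu> / Mbar)"
        using M_gt[of i] M_pos[of i] by simp
    qed
    then have "A K * (\<Prod>i=K..<k. 1 - sqrt (\<mu> / M i)) \<le> A K * (1 - sqrt (\<mu> / Mbar)) ^ (k - K)"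
      using A_pos[OF \<open>1 \<le> K\<close>] by simp
    with decay[of K k] that show ?thesis unfolding A_def by linarith
  qed
  have min_le: "\<phi>best (Suc k) \<le> min_value d (phi_reg d f \<mu> x0 (\<eta> (Suc k)))" for k
    unfolding min_value_def by (intro INF_greatest best_le)
  have decreasing: "\<phi>best (Suc k) \<le> \<phi>best k" for k
    unfolding \<phi>best by (rule abra_run_decreasing[OF run \<mu> x0])
  have product_rate: "1 / \<eta> k \<le> (M 0 - \<mu>) * (\<Prod>i=1..<k. 1 - sqrt (\<mu> / M i))" if "1 \<le> k" for k
    using decay[of 1 k] that unfolding A1 by (simp add: A_def)
  show ?thesis
    by (intro conjI allI impI decreasing min_le gap sum_rate sublinear_rate linear_rate product_rate)
      simp_all
qed

end
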